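(* There exist absolute constants $0<a\leq b$ such that for every integer $n\geq 2$ there exists a normal graph $G$ on $n$ vertices with $a\log_2 n\leq \omega(G)\leq b\log_2 n$ and $a\log_2 n\leq \alpha(G)\leq b\log_2 n$; that is, for all $n$ there is a normal graph with $n$ vertices whose clique number and independence number are both of order $\Theta(\log n)$.
   Context: A graph $G$ is normal if it admits a set $\mathcal C$ of cliques covering all vertices and a set $\mathcal S$ of stable sets covering all vertices such that every clique in $\mathcal C$ and every stable set in $\mathcal S$ have a vertex in common. $\omega(G)$ is the clique number and $\alpha(G)$ the independence number. *)

theory Defs
  imports Complex_Main "HOL-Library.Ramsey"
begin

definition finite_simple_graph :: "'a set \<Rightarrow> 'a set set \<Rightarrow> bool" where
  "finite_simple_graph V E \<longleftrightarrow> finite V \<and> E \<subseteq> nsets V 2"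

definition clique_number :: "'a set \<Rightarrow> 'a set set \<Rightarrow> nat" where
  "clique_number V E = Max {card K |K. K \<subseteq> V \<and> clique K E}"

definition independence_number :: "'a set \<Rightarrow> 'a set set \<Rightarrow> nat" where
  "independence_number V E = Max {card T |T. T \<subseteq> V \<and> indep T E}"

definition normal_graph :: "'a set \<Rightarrow> 'a set set \<Rightarrow> bool" where
  "normal_graph V E \<longleftrightarrow>
     (\<exists>\<C> \<S>. (\<forall>K\<in>\<C>. K \<subseteq> V \<and> clique K E) \<and> \<Union>\<C> = V \<and>
            (\<forall>T\<in>\<S>. T \<subseteq> V \<and> indep T E) \<and> \<Union>\<S> = V \<and>
            (\<forall>K\<in>\<C>. \<forall>T\<in>\<S>. K \<inter> T \<noteq> {}))"

end

theory Submission
  imports Defs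
begin

text \<open>
  Arrange the vertices \<open>1, \<dots>, n\<close> as a binary heap, so that \<open>x\<close> has parent \<open>x div 2\<close>. Take as
  cliques the root-to-leaf paths, and as stable sets, for every vertex \<open>x\<close>, the set consisting of
  \<open>x\<close> and the siblings of \<open>x\<close> and of its ancestors. Such a stable set is a cut of the tree, so every
  root-to-leaf path meets it, and both kinds of sets have logarithmic size. This forces adjacency
  of all comparable pairs and non-adjacency of all pairs \<open>u, y\<close> for which the sibling of \<open>u\<close> lies
  above \<open>y\<close>. Each vertex \<open>y\<close> is the lower end of only logarithmically many pairs of either
  kind, so a set of \<open>s\<close> vertices contains only \<open>O(s log n)\<close> forced pairs. Choosing all other
  pairs at random, the usual union bound excludes cliques and stable sets of size \<open>C log n\<close>.
\<close>

section \<open>Random completion of a partially specified graph\<close>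

text \<open>Counting form of a probability bound: a uniformly random subset of \<open>F\<close>
  contains \<open>P\<close> with probability 2^-|P|, or 0 if \<open>P\<close> leaves
  \<open>F\<close>.\<close>

lemma card_supersets_in_Pow:
  assumes "finite F"
  shows "card {A \<in> Pow F. P \<subseteq> A} * 2 ^ card P \<le> 2 ^ card F"
proof (cases "P \<subseteq> F")
  case True
  have finP: "finite P" using True assms finite_subset by blast
  have "inj_on (\<lambda>A. A - P) {A \<in> Pow F. P \<subseteq> A}"
    by (rule inj_onI) blast
  moreover have "(\<lambda>A. A - P) ` {A \<in> Pow F. P \<subseteq> A} \<subseteq> Pow (F - P)"
    by blast
  ultimately have "card {A \<in> Pow F. P \<subseteq> A} \<le> card (Pow (F - P))"
    by (intro card_inj_on_le) (use assms in auto)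
  also have "\<dots> = 2 ^ (card F - card P)"
    using True finP assms by (simp add: card_Pow card_Diff_subset)
  finally have "card {A \<in> Pow F. P \<subseteq> A} * 2 ^ card P \<le> 2 ^ (card F - card P) * 2 ^ card P"
    by (rule mult_le_mono1)
  also have "\<dots> = 2 ^ card F"
    using card_mono[OF assms True] by (simp flip: power_add)
  finally show ?thesis .
next
  case False
  then have "{A \<in> Pow F. P \<subseteq> A} = {}" by blast
  then show ?thesis by (simp only: card.empty mult_0 le0)
qed

text \<open>Complementation in \<open>F\<close> turns avoidance into containment. Points of
  \<open>P\<close> outside \<open>F\<close> would be avoided for free, hence the inclusion
  hypothesis.\<close>

lemma card_disjoint_in_Pow:
  assumes "finite F" "P \<subseteq> F"
  shows "card {A \<in> Pow F. P \<inter> A = {}} * 2 ^ card P \<le> 2 ^ card F"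
proof -
  have "inj_on (\<lambda>A. F - A) {A \<in> Pow F. P \<inter> A = {}}"
    by (rule inj_onI) blast
  moreover have "(\<lambda>A. F - A) ` {A \<in> Pow F. P \<inter> A = {}} \<subseteq> {A \<in> Pow F. P \<subseteq> A}"
    using assms(2) by blast
  ultimately have "card {A \<in> Pow F. P \<inter> A = {}} \<le> card {A \<in> Pow F. P \<subseteq> A}"
    by (intro card_inj_on_le) (use assms(1) in auto)
  then show ?thesis
    using card_supersets_in_Pow[OF assms(1), of P] by (meson mult_le_mono1 order_trans)
qed

text \<open>Each pair of \<open>D\<close> inside \<open>W\<close> is charged to its end
  \<open>y\<close> and an index \<open>i\<close>. As \<open>y\<close> lies in \<open>W\<close>, at
  most \<open>k * card W\<close> pairs are lost.\<close>

lemma card_unforced_pairs: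
  fixes f :: "'a \<Rightarrow> nat \<Rightarrow> 'a"
  assumes "finite W" and D: "\<And>e. e \<in> D \<Longrightarrow> \<exists>y i. i < k \<and> e = {f y i, y}"
  shows "(card W choose 2) - k * card W \<le> card (nsets W 2 - D)"
proof -
  let ?g = "\<lambda>(y, i). {f y i, y}"
  have "nsets W 2 \<inter> D \<subseteq> ?g ` (W \<times> {..<k})"
  proof
    fix e assume e: "e \<in> nsets W 2 \<inter> D"
    then obtain y i where "i < k" "e = {f y i, y}" using D by blast
    moreover have "y \<in> W" using e \<open>e = _\<close> by (auto simp: nsets_def)
    ultimately show "e \<in> ?g ` (W \<times> {..<k})" by force
  qed
  then have "card (nsets W 2 \<inter> D) \<le> card (W \<times> {..<k})"
    using assms(1) by (meson finite_SigmaI finite_lessThan surj_card_le)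
  then have "card (nsets W 2 \<inter> D) \<le> k * card W"
    by (simp add: card_cartesian_product mult.commute)
  moreover have "card (nsets W 2 - D) = (card W choose 2) - card (nsets W 2 \<inter> D)"
    using assms(1) by (simp add: card_Diff_subset_Int finite_imp_finite_nsets)
  ultimately show ?thesis by simp
qed

text \<open>Union bound over all \<open>s\<close>-sets \<open>W\<close>, with \<open>A\<close> a
  random subset of the free pairs. For \<open>W\<close> to be a clique, \<open>A\<close> must
  contain all its pairs outside \<open>E1\<close>; for \<open>W\<close> to be independent,
  \<open>A\<close> must avoid all its pairs outside \<open>E0\<close>. Either way at least
  \<open>(s choose 2) - k * s\<close> pairs are prescribed. The factor 2 in \<open>few\<close>
  counts these two events.\<close>

lemma exists_completion_without_large_homogeneous_sets:
  fixes V :: "'a set" and f g :: "'a \<Rightarrow> nat \<Rightarrow> 'a"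
  assumes "finite V"
    and E1: "\<And>e. e \<in> E1 \<Longrightarrow> \<exists>y i. i < k \<and> e = {f y i, y}"
    and E0: "\<And>e. e \<in> E0 \<Longrightarrow> \<exists>y i. i < k \<and> e = {g y i, y}"
    and few: "2 * (card V choose s) < 2 ^ ((s choose 2) - k * s)"
  obtains A where "A \<subseteq> nsets V 2 - E1 - E0"
    and "\<And>W. W \<in> nsets V s \<Longrightarrow> \<not> clique W (E1 \<union> A) \<and> \<not> indep W (E1 \<union> A)"
proof -
  define F where "F = nsets V 2 - E1 - E0"
  have finF: "finite F"
    using assms(1) by (simp add: F_def finite_imp_finite_nsets)
  define q where "q = (s choose 2) - k * s"
  define X where "X = (\<lambda>W. {A \<in> Pow F. nsets W 2 - E1 \<subseteq> A})"
  \<comment> \<open>An independent \<open>W\<close> has no pair in \<open>E1\<close>, so its pairs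
    outside \<open>E0\<close> lie in \<open>F\<close>. This must be recorded here; in
    \<open>X\<close> it follows from containment in \<open>A\<close>.\<close>
  define Y where "Y = (\<lambda>W. {A \<in> Pow F. nsets W 2 - E0 \<subseteq> F \<and> (nsets W 2 - E0) \<inter> A = {}})"
  have W: "finite W \<and> card W = s" if "W \<in> nsets V s" for W
    using that by (simp add: nsets_def)
  have X: "card (X W) * 2 ^ q \<le> 2 ^ card F" if "W \<in> nsets V s" for W
  proof -
    have "q \<le> card (nsets W 2 - E1)"
      using card_unforced_pairs[of W E1 k f] W[OF that] E1 by (simp add: q_def)
    then have "card (X W) * 2 ^ q \<le> card (X W) * 2 ^ card (nsets W 2 - E1)"
      by simp
    also have "\<dots> \<le> 2 ^ card F"
      unfolding X_def by (rule card_supersets_in_Pow[OF finF])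
    finally show ?thesis .
  qed
  have Y: "card (Y W) * 2 ^ q \<le> 2 ^ card F" if "W \<in> nsets V s" for W
  proof (cases "nsets W 2 - E0 \<subseteq> F")
    case True
    have "q \<le> card (nsets W 2 - E0)"
      using card_unforced_pairs[of W E0 k g] W[OF that] E0 by (simp add: q_def)
    then have "card (Y W) * 2 ^ q \<le> card (Y W) * 2 ^ card (nsets W 2 - E0)"
      by simp
    also have "\<dots> \<le> 2 ^ card F"
      using card_disjoint_in_Pow[OF finF True] True by (simp add: Y_def)
    finally show ?thesis .
  next
    case False
    then show ?thesis by (simp add: Y_def)
  qed
  define B where "B = (\<Union>W\<in>nsets V s. X W \<union> Y W)"
  have finV: "finite (nsets V s)"
    using assms(1) by (simp add: finite_imp_finite_nsets)
  have "card B * 2 ^ q \<le> (\<Sum>W\<in>nsets V s. card (X W) + card (Y W)) * 2 ^ q"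
    unfolding B_def
    by (intro mult_le_mono1 order_trans[OF card_UN_le[OF finV]] sum_mono card_Un_le)
  also have "\<dots> = (\<Sum>W\<in>nsets V s. card (X W) * 2 ^ q + card (Y W) * 2 ^ q)"
    by (simp only: sum_distrib_right distrib_right)
  also have "\<dots> \<le> (\<Sum>W\<in>nsets V s. 2 ^ card F + 2 ^ card F)"
    by (intro sum_mono add_mono X Y)
  also have "\<dots> = 2 * (card V choose s) * 2 ^ card F"
    by simp
  also have "\<dots> < 2 ^ q * 2 ^ card F"
    using few by (simp add: q_def)
  finally have "card B < card (Pow F)"
    using finF by (simp add: card_Pow)
  moreover have "B \<subseteq> Pow F"
    by (auto simp: B_def X_def Y_def)
  ultimately obtain A where A: "A \<in> Pow F" "A \<notin> B"
    by (metis psubset_eq subsetI order_less_irrefl subset_antisym)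
  show thesis
  proof (rule that)
    show "A \<subseteq> nsets V 2 - E1 - E0"
      using A by (auto simp: F_def)
    fix W assume Wn: "W \<in> nsets V s"
    then have "W \<subseteq> V" by (simp add: nsets_def)
    have "A \<notin> X W" "A \<notin> Y W"
      using A Wn by (auto simp: B_def)
    have "\<not> clique W (E1 \<union> A)"
    proof
      assume "clique W (E1 \<union> A)"
      then have "nsets W 2 \<subseteq> E1 \<union> A"
        by (auto simp: clique_def nsets_2_eq)
      then show False
        using \<open>A \<notin> X W\<close> A by (auto simp: X_def)
    qed
    moreover have "\<not> indep W (E1 \<union> A)"
    proof
      assume "indep W (E1 \<union> A)"
      then have "nsets W 2 \<inter> (E1 \<union> A) = {}"
        by (auto simp: indep_def nsets_2_eq)
      moreover have "nsets W 2 \<subseteq> nsets V 2"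
        using \<open>W \<subseteq> V\<close> by (rule nsets_mono)
      ultimately show False
        using \<open>A \<notin> Y W\<close> A by (auto simp: Y_def F_def)
    qed
    ultimately show "\<not> clique W (E1 \<union> A) \<and> \<not> indep W (E1 \<union> A)" by blast
  qed
qed

text \<open>For sets of size c*k the leading exponents are c*k^2 for the choice of the set and
  c^2*k^2/2 - c*k^2 for its unforced pairs, so c must exceed 4. With c = 6 the lower-order terms fit
  already at k = 1.\<close>

lemma two_times_choose_less:
  assumes "n < 2 ^ k" "0 < k"
  shows "2 * (n choose (6 * k)) < 2 ^ ((6 * k choose 2) - k * (6 * k))"
proof -
  have "n choose (6 * k) \<le> n ^ (6 * k)"
    by (cases "6 * k \<le> n") (simp_all add: binomial_le_pow binomial_eq_0)
  also have "\<dots> < (2 ^ k) ^ (6 * k)"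
    using assms by (intro power_strict_mono) auto
  finally have "2 * (n choose (6 * k)) < 2 ^ Suc (k * (6 * k))"
    by (simp add: power_mult)
  also have "\<dots> \<le> 2 ^ ((6 * k choose 2) - k * (6 * k))"
  proof (rule power_increasing)
    have "6 * k choose 2 = 3 * k * (6 * k - 1)"
      by (simp add: choose_two)
    also have "\<dots> = 18 * (k * k) - 3 * k"
      by (simp add: diff_mult_distrib2)
    finally have "6 * k choose 2 = 18 * (k * k) - 3 * k" .
    moreover have "k \<le> k * k" "1 \<le> k" using assms by auto
    ultimately show "Suc (k * (6 * k)) \<le> (6 * k choose 2) - k * (6 * k)"
      by linarith
  qed simp
  finally show ?thesis .
qed

section \<open>The heap-ordered binary tree\<close>

text \<open>Ancestor or equal: the binary expansion of \<open>x\<close> is a prefix of that of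
  \<open>y\<close>. Positivity excludes 0, where repeated halving ends.\<close>

definition heap_above :: "nat \<Rightarrow> nat \<Rightarrow> bool" where
  "heap_above x y \<longleftrightarrow> 0 < x \<and> (\<exists>i. x = y div 2 ^ i)"

text \<open>Flips the last binary digit. The root 1 is sent to 0, which is not a vertex; hence the
  bounds \<open>2 \<le> u\<close> below.\<close>

definition heap_sibling :: "nat \<Rightarrow> nat" where
  "heap_sibling x = (if even x then x + 1 else x - 1)"

lemma heap_sibling_sibling [simp]: "heap_sibling (heap_sibling x) = x"
  by (auto simp: heap_sibling_def)

lemma heap_sibling_div_2 [simp]: "heap_sibling x div 2 = x div 2"
  by (auto simp: heap_sibling_def elim!: oddE)

lemma heap_above_refl: "0 < x \<Longrightarrow> heap_above x x"
  unfolding heap_above_def by (auto intro: exI[of _ 0])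

lemma heap_above_le: "heap_above x y \<Longrightarrow> x \<le> y"
  unfolding heap_above_def by auto

lemma heap_above_pos: "heap_above x y \<Longrightarrow> 0 < x"
  by (simp add: heap_above_def)

lemma heap_above_trans: "heap_above x y \<Longrightarrow> heap_above y z \<Longrightarrow> heap_above x z"
  unfolding heap_above_def by (auto simp flip: div_mult2_eq power_add)

lemma heap_above_div_2: "heap_above x (y div 2) \<Longrightarrow> heap_above x y"
  unfolding heap_above_def by (auto simp flip: div_mult2_eq power_Suc)

lemma heap_above_iff_parent: "heap_above x y \<longleftrightarrow> 0 < x \<and> (x = y \<or> heap_above x (y div 2))"
proof
  assume "heap_above x y"
  then obtain i where "0 < x" "x = y div 2 ^ i" by (auto simp: heap_above_def)
  then show "0 < x \<and> (x = y \<or> heap_above x (y div 2))"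
    by (cases i) (auto simp: heap_above_def div_mult2_eq)
qed (use heap_above_div_2 heap_above_refl in blast)

lemma heap_above_linear:
  assumes "heap_above x z" "heap_above y z"
  shows "heap_above x y \<or> heap_above y x"
proof -
  have *: "heap_above (z div 2 ^ j) (z div 2 ^ i)" if "i \<le> j" "0 < z div 2 ^ j" for i j
    using that unfolding heap_above_def
    by (metis div_mult2_eq le_add_diff_inverse power_add)
  from assms obtain i j where "x = z div 2 ^ i" "y = z div 2 ^ j" "0 < x" "0 < y"
    by (auto simp: heap_above_def)
  then show ?thesis
    using *[of i j] *[of j i] by (cases "i \<le> j") auto
qed

text \<open>Since \<open>x\<close> is positive, \<open>2 ^ i \<le> y\<close>. This supplies the
  index range needed for charging forced pairs to their lower ends.\<close>

lemma heap_above_exponent_less: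
  assumes "heap_above x y" "y < 2 ^ k"
  shows "\<exists>i<k. x = y div 2 ^ i"
proof -
  obtain i where i: "0 < x" "x = y div 2 ^ i"
    using assms by (auto simp: heap_above_def)
  have "(2::nat) ^ i \<le> y" using i by (metis div_less gr_implies_not0 not_le)
  then have "i < k" using assms(2)
    by (meson le_less_trans one_less_numeral_iff power_less_imp_less_exp semiring_norm(76))
  then show ?thesis using i by blast
qed

lemma not_heap_above_sibling:
  assumes "2 \<le> u"
  shows "\<not> heap_above (heap_sibling u) u"
proof
  assume "heap_above (heap_sibling u) u"
  \<comment> \<open>A proper ancestor of \<open>u\<close> is at most \<open>u div 2\<close>, too
    small to be the sibling.\<close>
  moreover have "heap_sibling u \<noteq> u" "u div 2 < heap_sibling u"
    using assms by (auto simp: heap_sibling_def elim!: oddE evenE)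
  ultimately show False
    using heap_above_iff_parent[of "heap_sibling u" u] heap_above_le by fastforce
qed

lemma heap_sibling_ge_2: "2 \<le> u \<Longrightarrow> 2 \<le> heap_sibling u"
  by (auto simp: heap_sibling_def elim!: oddE)

lemma not_heap_above_both_siblings:
  assumes "2 \<le> u" "heap_above u y" "heap_above (heap_sibling u) y"
  shows False
  using heap_above_linear[OF assms(2,3)] not_heap_above_sibling[OF assms(1)]
    not_heap_above_sibling[OF heap_sibling_ge_2[OF assms(1)]] by auto

text \<open>Siblings share a parent, so a proper ancestor of one is an ancestor of the
  other.\<close>

lemma heap_above_sibling_sibling:
  assumes "heap_above (heap_sibling u) (heap_sibling v)" "u \<noteq> v"
  shows "heap_above (heap_sibling u) v"
proof -
  have "heap_sibling u \<noteq> heap_sibling v"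
    using assms(2) by (metis heap_sibling_sibling)
  then have "heap_above (heap_sibling u) (v div 2)"
    using assms(1) heap_above_iff_parent[of "heap_sibling u" "heap_sibling v"] by auto
  then show ?thesis by (rule heap_above_div_2)
qed

text \<open>Below the last common ancestor of \<open>x\<close> and \<open>y\<close>, the vertex
  \<open>u\<close> is the child on the side of \<open>y\<close> and its sibling the child on the
  side of \<open>x\<close>. The induction halves the larger vertex until both have the same
  parent.\<close>

lemma heap_branching:
  assumes "0 < x" "0 < y" "\<not> heap_above x y" "\<not> heap_above y x"
  shows "\<exists>u\<ge>2. heap_above u y \<and> heap_above (heap_sibling u) x"
  using assms
proof (induction "x + y" arbitrary: x y rule: less_induct)
  case less
  have ge2: "2 \<le> x \<and> 2 \<le> y"
  proof -
    have "heap_above 1 z" if "0 < z" for z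
      using that
    proof (induction z rule: less_induct)
      case (less z)
      then show ?case
        using heap_above_div_2[of 1 z] less.IH[of "z div 2"]
        by (cases "z = 1") (auto simp: heap_above_refl div_greater_zero_iff)
    qed
    from this[of x] this[of y] have "x \<noteq> 1" "y \<noteq> 1" using less.prems by auto
    then show ?thesis using less.prems by linarith
  qed
  show ?case
  proof (cases "x div 2 = y div 2")
    case True
    have "x \<noteq> y" using less.prems heap_above_refl by auto
    have "heap_sibling y = x"
      using True \<open>x \<noteq> y\<close> by (auto simp: heap_sibling_def elim!: oddE evenE)
    then show ?thesis
      using ge2 less.prems heap_above_refl by (intro exI[of _ y]) auto
  next
    case False
    have pos: "0 < x div 2" "0 < y div 2" using ge2 by (auto simp: div_greater_zero_iff)
    show ?thesis
    proof (cases "x \<le> y")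
      case True
      \<comment> \<open>Halving the larger vertex preserves incomparability: were
        \<open>y div 2\<close> a proper ancestor of \<open>x\<close>, then
        \<open>y div 2 \<le> x div 2\<close>, and \<open>x \<le> y\<close> would make the parents
        equal.\<close>
      have "\<not> heap_above x (y div 2)"
        using less.prems heap_above_div_2 by blast
      moreover have "\<not> heap_above (y div 2) x"
      proof
        assume a: "heap_above (y div 2) x"
        have "y div 2 \<noteq> x"
          using a \<open>\<not> heap_above x (y div 2)\<close> by auto
        then have "heap_above (y div 2) (x div 2)"
          using a heap_above_iff_parent by blast
        then have "y div 2 \<le> x div 2" by (rule heap_above_le)
        then show False using False True by (meson antisym div_le_mono)
      qed
      ultimately obtain u where "2 \<le> u" "heap_above u (y div 2)" "heap_above (heap_sibling u) x"
        using less.hyps[of x "y div 2"] pos ge2 less.prems by auto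
      then show ?thesis using heap_above_div_2 by blast
    next
      case greater: False
      have "\<not> heap_above y (x div 2)"
        using less.prems heap_above_div_2 by blast
      moreover have "\<not> heap_above (x div 2) y"
      proof
        assume a: "heap_above (x div 2) y"
        have "x div 2 \<noteq> y"
          using a \<open>\<not> heap_above y (x div 2)\<close> by auto
        then have "heap_above (x div 2) (y div 2)"
          using a heap_above_iff_parent by blast
        then have "x div 2 \<le> y div 2" by (rule heap_above_le)
        then show False using False greater by (meson antisym div_le_mono nle_le)
      qed
      ultimately obtain u where "2 \<le> u" "heap_above u y" "heap_above (heap_sibling u) (x div 2)"
        using less.hyps[of "x div 2" y] pos ge2 less.prems by auto
      then show ?thesis using heap_above_div_2 by blast
    qed
  qed
qed

section \<open>Forced edges and forced non-edges\<close>

definition heap_edges :: "nat \<Rightarrow> nat set set" where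
  "heap_edges n = {{x, y} |x y. y \<le> n \<and> heap_above x y \<and> x \<noteq> y}"

text \<open>In this form \<open>u\<close> is the sibling of some \<open>y div 2 ^ i\<close>, so
  \<open>y\<close> and \<open>i\<close> determine the pair.\<close>

definition heap_nonedges :: "nat \<Rightarrow> nat set set" where
  "heap_nonedges n = {{u, y} |u y. 2 \<le> u \<and> u \<le> n \<and> y \<le> n \<and> heap_above (heap_sibling u) y}"

text \<open>A common pair would put \<open>u\<close> and its sibling above one vertex, or the
  sibling of \<open>u\<close> above \<open>u\<close>.\<close>

lemma heap_edges_nonedges_disjoint: "heap_edges n \<inter> heap_nonedges n = {}"
proof -
  have False if "heap_above x y" "2 \<le> u" "heap_above (heap_sibling u) v" "{x, y} = {u, v}"
    for x y u v
  proof -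
    from that(4) consider "x = u" "y = v" | "x = v" "y = u"
      by (auto simp: doubleton_eq_iff)
    then show False
    proof cases
      case 1
      then show False using that not_heap_above_both_siblings by blast
    next
      case 2
      then have "heap_above (heap_sibling u) u"
        using that heap_above_trans by blast
      then show False using not_heap_above_sibling that(2) by blast
    qed
  qed
  then show ?thesis
    unfolding heap_edges_def heap_nonedges_def by blast
qed

section \<open>Paths, cuts and normality\<close>

definition heap_path :: "nat \<Rightarrow> nat set" where
  "heap_path l = {x. heap_above x l}"

text \<open>The bound \<open>u \<le> n\<close> drops the sibling \<open>n + 1\<close> that
  \<open>n\<close> has when \<open>n\<close> is even.\<close>

definition heap_cut :: "nat \<Rightarrow> nat \<Rightarrow> nat set" where
  "heap_cut n x = insert x {u. 2 \<le> u \<and> u \<le> n \<and> heap_above (heap_sibling u) x}"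

lemma clique_heap_path:
  assumes "l \<le> n" "heap_edges n \<subseteq> E"
  shows "clique (heap_path l) E"
proof -
  have "{x, y} \<in> heap_edges n" if "heap_above x l" "heap_above y l" "x \<noteq> y" for x y
  proof -
    have "x \<le> n" "y \<le> n" using that heap_above_le assms(1) by fastforce+
    then show ?thesis
      using heap_above_linear[OF that(1,2)] that(3)
      unfolding heap_edges_def by (auto simp: insert_commute)
  qed
  then show ?thesis
    using assms(2) unfolding clique_def heap_path_def by blast
qed

text \<open>For two members \<open>u\<close>, \<open>v\<close> other than \<open>x\<close>, their
  siblings are both above \<open>x\<close>, hence comparable. The upper sibling is then above the
  other member itself, which makes the pair a forced non-edge.\<close>

lemma indep_heap_cut:
  assumes "x \<le> n" "E \<inter> heap_nonedges n = {}"
  shows "indep (heap_cut n x) E"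
proof -
  have *: "{u, v} \<in> heap_nonedges n"
    if u: "2 \<le> u" "u \<le> n" "heap_above (heap_sibling u) x"
      and v: "v = x \<or> (2 \<le> v \<and> v \<le> n \<and> heap_above (heap_sibling v) x)" and "u \<noteq> v" for u v
  proof (cases "v = x")
    case True
    then show ?thesis using u assms(1) unfolding heap_nonedges_def by blast
  next
    case False
    then have v': "2 \<le> v" "v \<le> n" "heap_above (heap_sibling v) x" using v by auto
    have "heap_above (heap_sibling u) v \<or> heap_above (heap_sibling v) u"
      using heap_above_linear[OF u(3) v'(3)] heap_above_sibling_sibling \<open>u \<noteq> v\<close> by blast
    then show ?thesis
      using u v' unfolding heap_nonedges_def by (auto simp: insert_commute)
  qed
  have "{u, v} \<in> heap_nonedges n" if "u \<in> heap_cut n x" "v \<in> heap_cut n x" "u \<noteq> v" for u v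
    using that *[of u v] *[of v u] unfolding heap_cut_def by (auto simp: insert_commute)
  then show ?thesis
    using assms(2) unfolding indep_def by blast
qed

text \<open>\<open>n < 2 * l\<close> makes \<open>l\<close> a leaf, so an \<open>x\<close> off the
  path is incomparable to \<open>l\<close>. The branching vertex on the side of \<open>l\<close>
  then lies on the path, and its sibling is above \<open>x\<close>.\<close>

lemma heap_path_meets_heap_cut:
  assumes "0 < l" "l \<le> n" "n < 2 * l" "0 < x" "x \<le> n"
  shows "heap_path l \<inter> heap_cut n x \<noteq> {}"
proof (cases "heap_above x l")
  case True
  then show ?thesis by (auto simp: heap_path_def heap_cut_def)
next
  case False
  have "\<not> heap_above l x"
  proof
    assume a: "heap_above l x"
    moreover have "l \<noteq> x" using False assms heap_above_refl by blast
    ultimately have "l \<le> x div 2"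
      using heap_above_iff_parent heap_above_le by blast
    then show False using assms by linarith
  qed
  then obtain u where u: "2 \<le> u" "heap_above u l" "heap_above (heap_sibling u) x"
    using heap_branching[of x l] False assms by blast
  moreover have "u \<le> n" using heap_above_le[OF u(2)] assms by linarith
  ultimately show ?thesis
    unfolding heap_path_def heap_cut_def by blast
qed

lemma heap_leaf_below:
  assumes "0 < x" "x \<le> n"
  shows "\<exists>l\<le>n. n < 2 * l \<and> heap_above x l"
  using assms
proof (induction "n - x" arbitrary: x rule: less_induct)
  case less
  show ?case
  \<comment> \<open>Descend to the left child as long as it exists.\<close>
  proof (cases "2 * x \<le> n")
    case True
    then obtain l where l: "l \<le> n" "n < 2 * l" "heap_above (2 * x) l"
      using less.hyps[of "2 * x"] less.prems by (auto simp: diff_less_mono2)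
    moreover have "heap_above x (2 * x)"
      using heap_above_div_2[of x "2 * x"] less.prems heap_above_refl by auto
    ultimately show ?thesis using heap_above_trans by blast
  next
    case False
    then show ?thesis using less.prems heap_above_refl by (intro exI[of _ x]) auto
  qed
qed

lemma heap_path_subset: "l \<le> n \<Longrightarrow> heap_path l \<subseteq> {1..n}"
  unfolding heap_path_def using heap_above_le heap_above_pos by fastforce

lemma heap_cut_subset: "0 < x \<Longrightarrow> x \<le> n \<Longrightarrow> heap_cut n x \<subseteq> {1..n}"
  unfolding heap_cut_def by auto

text \<open>Normality depends only on the forced pairs, which leaves all others free for the random
  choice.\<close>

lemma normal_graph_heap:
  assumes "heap_edges n \<subseteq> E" "E \<inter> heap_nonedges n = {}"
  shows "normal_graph {1..n} E"
proof -
  define \<C> where "\<C> = heap_path ` {l. 0 < l \<and> l \<le> n \<and> n < 2 * l}"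
  define \<S> where "\<S> = heap_cut n ` {1..n}"
  have "\<Union>\<C> = {1..n}"
  proof
    show "\<Union>\<C> \<subseteq> {1..n}" unfolding \<C>_def using heap_path_subset by blast
    show "{1..n} \<subseteq> \<Union>\<C>"
    proof
      fix x assume x: "x \<in> {1..n}"
      then obtain l where l: "l \<le> n" "n < 2 * l" "heap_above x l"
        using heap_leaf_below[of x n] by auto
      then have "0 < l" by linarith
      then show "x \<in> \<Union>\<C>"
        using l unfolding \<C>_def heap_path_def by blast
    qed
  qed
  moreover have "\<Union>\<S> = {1..n}"
  proof
    have "heap_cut n x \<subseteq> {1..n}" if "x \<in> {1..n}" for x
      using heap_cut_subset[of x n] that by simp
    then show "\<Union>\<S> \<subseteq> {1..n}" unfolding \<S>_def by blast
    show "{1..n} \<subseteq> \<Union>\<S>" unfolding \<S>_def heap_cut_def by blast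
  qed
  moreover have "\<forall>K\<in>\<C>. clique K E"
    unfolding \<C>_def using clique_heap_path assms(1) by blast
  moreover have "\<forall>T\<in>\<S>. indep T E"
    unfolding \<S>_def using indep_heap_cut[OF _ assms(2)] by simp
  moreover have "\<forall>K\<in>\<C>. \<forall>T\<in>\<S>. K \<inter> T \<noteq> {}"
    unfolding \<C>_def \<S>_def using heap_path_meets_heap_cut by (simp add: Suc_le_eq)
  ultimately show ?thesis
    unfolding normal_graph_def by (metis Union_upper)
qed

section \<open>Bounds on the clique and independence numbers\<close>

lemma card_heap_path_power: "card (heap_path (2 ^ m)) \<ge> Suc m"
proof -
  \<comment> \<open>The vertex \<open>2 ^ m\<close> is the leftmost at depth \<open>m\<close>; its
    ancestors are the smaller powers of 2.\<close>
  have "(\<lambda>i. 2 ^ i) ` {..m} \<subseteq> heap_path (2 ^ m)"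
  proof -
    have "heap_above (2 ^ i) (2 ^ m)" if "i \<le> m" for i
      unfolding heap_above_def
      using that by (intro conjI exI[of _ "m - i"]) (simp_all add: power_diff_power_eq)
    then show ?thesis by (auto simp: heap_path_def)
  qed
  moreover have "finite (heap_path (2 ^ m))"
    using heap_path_subset[of "2 ^ m" "2 ^ m"] finite_subset by blast
  ultimately have "card ((\<lambda>i. 2 ^ i :: nat) ` {..m}) \<le> card (heap_path (2 ^ m))"
    by (intro card_mono)
  moreover have "inj_on (\<lambda>i. 2 ^ i :: nat) {..m}" by (auto simp: inj_on_def)
  ultimately show ?thesis by (simp add: card_image)
qed

lemma card_heap_cut_power:
  assumes "2 ^ m \<le> n"
  shows "m \<le> card (heap_cut n (2 ^ m))"
proof -
  \<comment> \<open>The sibling of \<open>2 ^ i\<close> is \<open>2 ^ i + 1\<close>. Index 0 is the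
    root, and \<open>2 ^ m + 1\<close> may exceed \<open>n\<close>, so \<open>m - 1\<close> siblings
    remain besides \<open>2 ^ m\<close>.\<close>
  have sub: "insert (2 ^ m) ((\<lambda>i. 2 ^ i + 1) ` {1..<m}) \<subseteq> heap_cut n (2 ^ m)"
  proof -
    have "2 ^ i + 1 \<le> n \<and> 2 \<le> (2 ^ i + 1 :: nat) \<and> heap_above (heap_sibling (2 ^ i + 1)) (2 ^ m)"
      if "1 \<le> i" "i < m" for i
    proof -
      have "(2::nat) ^ i < 2 ^ m" using that by simp
      moreover have "heap_sibling (2 ^ i + 1) = 2 ^ i"
        using that by (auto simp: heap_sibling_def)
      moreover have "heap_above (2 ^ i) (2 ^ m)"
        unfolding heap_above_def
        using that by (intro conjI exI[of _ "m - i"]) (simp_all add: power_diff_power_eq)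
      ultimately show ?thesis
        using assms by (auto simp: Suc_le_eq simp del: power_strict_increasing_iff)
    qed
    then show ?thesis by (auto simp: heap_cut_def)
  qed
  have "finite (heap_cut n (2 ^ m))"
    using heap_cut_subset[of "2 ^ m" n] assms finite_subset by fastforce
  from card_mono[OF this sub]
  have "card (insert (2 ^ m) ((\<lambda>i. 2 ^ i + 1 :: nat) ` {1..<m})) \<le> card (heap_cut n (2 ^ m))" .
  moreover have "inj_on (\<lambda>i. 2 ^ i + 1 :: nat) {1..<m}" by (auto simp: inj_on_def)
  moreover have "(2::nat) ^ m \<notin> (\<lambda>i. 2 ^ i + 1) ` {1..<m}"
  proof
    assume "(2::nat) ^ m \<in> (\<lambda>i. 2 ^ i + 1) ` {1..<m}"
    then obtain i where i: "1 \<le> i" "i < m" "(2::nat) ^ m = 2 ^ i + 1" by auto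
    have "even ((2::nat) ^ m)" "odd ((2::nat) ^ i + 1)" using i(1,2) by auto
    then show False using i(3) by metis
  qed
  ultimately show ?thesis by (simp add: card_image)
qed

text \<open>Shared by both graph parameters. The witness \<open>K\<close> also makes the set
  nonempty, so that \<open>Max\<close> is meaningful.\<close>

lemma Max_card_bounds:
  assumes "finite V" "K \<subseteq> V" "P K"
    and "\<And>W. W \<subseteq> V \<Longrightarrow> P W \<Longrightarrow> card W < s"
  shows "card K \<le> Max {card K |K. K \<subseteq> V \<and> P K}" "Max {card K |K. K \<subseteq> V \<and> P K} < s"
proof -
  have "{card K |K. K \<subseteq> V \<and> P K} \<subseteq> card ` Pow V" by auto
  then have "finite {card K |K. K \<subseteq> V \<and> P K}"
    using assms(1) by (meson finite_Pow_iff finite_imageI finite_subset)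
  then show "card K \<le> Max {card K |K. K \<subseteq> V \<and> P K}" "Max {card K |K. K \<subseteq> V \<and> P K} < s"
    using assms by (blast intro: Max_ge, subst Max_less_iff) (use assms in blast)+
qed

lemma exists_normal_graph:
  fixes n m :: nat
  assumes m: "2 ^ m \<le> n" "n < 2 ^ Suc m"
  shows "\<exists>E. finite_simple_graph {1..n} E \<and> normal_graph {1..n} E \<and>
     Suc m \<le> clique_number {1..n} E \<and> clique_number {1..n} E < 6 * Suc m \<and>
     m \<le> independence_number {1..n} E \<and> independence_number {1..n} E < 6 * Suc m"
proof -
  \<comment> \<open>\<open>?k\<close> is the number of levels of the heap.\<close>
  let ?V = "{1..n}" and ?k = "Suc m"
  have "\<exists>y i. i < ?k \<and> e = {y div 2 ^ i, y}" if "e \<in> heap_edges n" for e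
  proof -
    from that obtain x y where "e = {x, y}" "y \<le> n" "heap_above x y"
      unfolding heap_edges_def by blast
    then show ?thesis using heap_above_exponent_less[of x y ?k] m by force
  qed
  moreover have "\<exists>y i. i < ?k \<and> e = {heap_sibling (y div 2 ^ i), y}"
    if "e \<in> heap_nonedges n" for e
  proof -
    from that obtain u y where e: "e = {u, y}" "y \<le> n" "heap_above (heap_sibling u) y"
      unfolding heap_nonedges_def by blast
    then obtain i where "i < ?k" "heap_sibling u = y div 2 ^ i"
      using heap_above_exponent_less[of "heap_sibling u" y ?k] m by force
    then show ?thesis using e(1) heap_sibling_sibling[of u] by metis
  qed
  moreover have "2 * (card ?V choose (6 * ?k)) < 2 ^ ((6 * ?k choose 2) - ?k * (6 * ?k))"
    using two_times_choose_less[of n ?k] m(2) by simp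
  ultimately obtain A where A: "A \<subseteq> nsets ?V 2 - heap_edges n - heap_nonedges n"
    and hom: "\<And>W. W \<in> nsets ?V (6 * ?k) \<Longrightarrow>
      \<not> clique W (heap_edges n \<union> A) \<and> \<not> indep W (heap_edges n \<union> A)"
    using exists_completion_without_large_homogeneous_sets[of ?V "heap_edges n" ?k
        "\<lambda>y i. y div 2 ^ i" "heap_nonedges n" "\<lambda>y i. heap_sibling (y div 2 ^ i)" "6 * ?k"]
    by (metis (no_types, lifting) finite_atLeastAtMost)
  define E where "E = heap_edges n \<union> A"
  have disj: "E \<inter> heap_nonedges n = {}"
    using A heap_edges_nonedges_disjoint unfolding E_def by blast
  have "heap_edges n \<subseteq> nsets ?V 2"
  proof
    fix e assume "e \<in> heap_edges n"
    then obtain x y where e: "e = {x, y}" "y \<le> n" "heap_above x y" "x \<noteq> y"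
      unfolding heap_edges_def by blast
    then show "e \<in> nsets ?V 2"
      using heap_above_le[OF e(3)] heap_above_pos[OF e(3)] by (auto simp: nsets_def)
  qed
  then have graph: "finite_simple_graph ?V E"
    using A unfolding finite_simple_graph_def E_def by auto
  have normal: "normal_graph ?V E"
    using normal_graph_heap disj by (simp add: E_def)
  \<comment> \<open>Excluding size exactly \<open>6 * ?k\<close> suffices, since cliques and
    independent sets are closed under subsets.\<close>
  have small: "card W < 6 * ?k" if "W \<subseteq> ?V" "clique W E \<or> indep W E" for W
  proof (rule ccontr)
    assume "\<not> card W < 6 * ?k"
    then obtain U where U: "U \<subseteq> W" "card U = 6 * ?k" "finite U"
      by (meson not_le obtain_subset_with_card_n)
    then have "U \<in> nsets ?V (6 * ?k)" using that(1) by (auto simp: nsets_def)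
    moreover have "clique U E \<or> indep U E"
      using that(2) U(1) by (auto simp: clique_def indep_def)
    ultimately show False using hom E_def by blast
  qed
  have "Suc m \<le> clique_number ?V E \<and> clique_number ?V E < 6 * ?k"
    using Max_card_bounds[of ?V "heap_path (2 ^ m)" "\<lambda>K. clique K E" "6 * ?k"] small
      heap_path_subset[OF m(1)] clique_heap_path[OF m(1), of E] card_heap_path_power[of m]
    by (fastforce simp: clique_number_def E_def)
  moreover have "m \<le> independence_number ?V E \<and> independence_number ?V E < 6 * ?k"
    using Max_card_bounds[of ?V "heap_cut n (2 ^ m)" "\<lambda>K. indep K E" "6 * ?k"] small
      heap_cut_subset[OF _ m(1)] indep_heap_cut[OF m(1) disj] card_heap_cut_power[OF m(1)]
    by (fastforce simp: independence_number_def)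
  ultimately show ?thesis using graph normal by blast
qed

theorem theorem3:
  shows "\<exists>a b :: real. 0 < a \<and> a \<le> b \<and>
    (\<forall>n::nat. n \<ge> 2 \<longrightarrow>
      (\<exists>(V :: nat set) E. finite_simple_graph V E \<and> card V = n \<and> normal_graph V E \<and>
        a * log 2 (real n) \<le> real (clique_number V E) \<and>
        real (clique_number V E) \<le> b * log 2 (real n) \<and>
        a * log 2 (real n) \<le> real (independence_number V E) \<and>
        real (independence_number V E) \<le> b * log 2 (real n)))"
proof (rule exI[of _ "1/2"], rule exI[of _ 12], intro conjI allI impI)
  fix n :: nat assume n: "n \<ge> 2"
  obtain m where m: "2 ^ m \<le> n" "n < 2 ^ Suc m"
    using ex_power_ivl1[of 2 n] n by auto
  \<comment> \<open>From \<open>m \<ge> 1\<close> follows \<open>Suc m \<le> 2 * m\<close>. This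
    yields both constants: \<open>6 * Suc m \<le> 12 * m\<close> and
    \<open>log 2 n < 2 * m\<close>.\<close>
  have "m \<noteq> 0"
    using m n by (intro notI) simp
  have lower: "real m \<le> log 2 (real n)"
    using m(1) n by (simp add: le_log_of_power)
  have upper: "log 2 (real n) < real (Suc m)"
    using m(2) n by (intro log2_of_power_less) simp_all
  obtain E where E: "finite_simple_graph {1..n} E" "normal_graph {1..n} E"
     "Suc m \<le> clique_number {1..n} E" "clique_number {1..n} E < 6 * Suc m"
     "m \<le> independence_number {1..n} E" "independence_number {1..n} E < 6 * Suc m"
    using exists_normal_graph[OF m] by blast
  have b: "real (6 * Suc m) \<le> 12 * log 2 (real n)"
    using lower \<open>m \<noteq> 0\<close> by simp
  have a: "1 / 2 * log 2 (real n) \<le> real m"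
    using upper \<open>m \<noteq> 0\<close> by simp
  show "\<exists>(V :: nat set) E. finite_simple_graph V E \<and> card V = n \<and> normal_graph V E \<and>
        1 / 2 * log 2 (real n) \<le> real (clique_number V E) \<and>
        real (clique_number V E) \<le> 12 * log 2 (real n) \<and>
        1 / 2 * log 2 (real n) \<le> real (independence_number V E) \<and>
        real (independence_number V E) \<le> 12 * log 2 (real n)"
    using E a b by (intro exI[of _ "{1..n}"] exI[of _ E]) auto
qed simp_all

end
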